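(* Let $\alpha_1,\dots,\alpha_6$ be complex numbers satisfying $|\alpha_1+\alpha_3+\alpha_5|-|\alpha_2+\alpha_4+\alpha_6|\neq 0$. Let $\mathcal{A}$ and $\mathcal{B}$ be two unital complex $\ast$-algebras with multiplicative identities $1_{\mathcal{A}}$ and $1_{\mathcal{B}}$, respectively, such that $\mathcal{A}$ is prime and has a nontrivial projection. Then every bijective (not necessarily linear or additive) map $\Phi:\mathcal{A}\rightarrow\mathcal{B}$ satisfying $$\begin{aligned}&\Phi(\alpha_1 abc+\alpha_2 a^{*}cb^{*}+\alpha_3 ba^{*}c+\alpha_4 cab^{*}+\alpha_5 bca+\alpha_6 cb^{*}a^{*})\\&=\alpha_1\Phi(a)\Phi(b)\Phi(c)+\alpha_2\Phi(a)^{*}\Phi(c)\Phi(b)^{*}+\alpha_3\Phi(b)\Phi(a)^{*}\Phi(c)\\&\quad+\alpha_4\Phi(c)\Phi(a)\Phi(b)^{*}+\alpha_5\Phi(b)\Phi(c)\Phi(a)+\alpha_6\Phi(c)\Phi(b)^{*}\Phi(a)^{*}\end{aligned}$$ for all $a,b,c\in\mathcal{A}$ is additive. In addition, if (i) $\Phi(1_{\mathcal{A}})$ is a projection of $\mathcal{B}$ and (ii) $\alpha_2+\alpha_4+\alpha_6\neq 0$ and $\Phi((\alpha_2+\alpha_4+\alpha_6)a)=(\alpha_2+\alpha_4+\alpha_6)\Phi(a)$ for all $a\in\mathcal{A}$, then $\Phi$ is a $\ast$-ring isomorphism.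
   Context: A complex $\ast$-algebra is an associative algebra over $\mathbb{C}$ with an involution $\ast$, i.e. a conjugate-linear map $a\mapsto a^{*}$ with $(ab)^{*}=b^{*}a^{*}$ and $(a^{*})^{*}=a$. A projection is an element $p$ with $p=p^{*}=p^{2}$; it is nontrivial if it is different from $0$ and the identity. The algebra $\mathcal{A}$ is prime if, for $a,b\in\mathcal{A}$, $a\mathcal{A}b=\{0\}$ implies $a=0$ or $b=0$. A $\ast$-ring isomorphism is a bijective map $\Phi$ that is additive, multiplicative ($\Phi(ab)=\Phi(a)\Phi(b)$) and satisfies $\Phi(a^{*})=\Phi(a)^{*}$ for all elements $a,b$ (no complex-linearity is required). *)

theory Defs
  imports Complex_Main
begin

text \<open>The identity is assumed separately (class \<open>monoid_mult\<close>) instead of via \<open>ring_1\<close>,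
  which would impose \<open>0 \<noteq> 1\<close>.\<close>

class complex_star_algebra = ring +
  fixes scaleC :: "complex \<Rightarrow> 'a \<Rightarrow> 'a" (infixr "*\<^sub>C" 75)
    and star :: "'a \<Rightarrow> 'a" ("(_\<^sup>\<star>)" [1000] 999)
  assumes scaleC_add_right: "r *\<^sub>C (a + b) = r *\<^sub>C a + r *\<^sub>C b"
    and scaleC_add_left: "(r + s) *\<^sub>C a = r *\<^sub>C a + s *\<^sub>C a"
    and scaleC_scaleC: "r *\<^sub>C s *\<^sub>C a = (r * s) *\<^sub>C a"
    and scaleC_one: "1 *\<^sub>C a = a"
    and mult_scaleC_left: "(r *\<^sub>C a) * b = r *\<^sub>C (a * b)"
    and mult_scaleC_right: "a * (r *\<^sub>C b) = r *\<^sub>C (a * b)"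
    and star_add: "(a + b)\<^sup>\<star> = a\<^sup>\<star> + b\<^sup>\<star>"
    and star_scaleC: "(r *\<^sub>C a)\<^sup>\<star> = cnj r *\<^sub>C a\<^sup>\<star>"
    and star_mult: "(a * b)\<^sup>\<star> = b\<^sup>\<star> * a\<^sup>\<star>"
    and star_star: "(a\<^sup>\<star>)\<^sup>\<star> = a"

class unital_complex_star_algebra = complex_star_algebra + monoid_mult

definition is_projection :: "'a::complex_star_algebra \<Rightarrow> bool" where
  "is_projection p \<longleftrightarrow> p = p\<^sup>\<star> \<and> p = p * p"

definition nontrivial_projection :: "'a::unital_complex_star_algebra \<Rightarrow> bool" where
  "nontrivial_projection p \<longleftrightarrow> is_projection p \<and> p \<noteq> 0 \<and> p \<noteq> 1"

definition prime_algebra :: "'a::complex_star_algebra itself \<Rightarrow> bool" where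
  "prime_algebra _ \<longleftrightarrow> (\<forall>a b :: 'a. (\<forall>x. a * x * b = 0) \<longrightarrow> a = 0 \<or> b = 0)"

text \<open>No compatibility with \<open>*\<^sub>C\<close> is required.\<close>

definition star_ring_isomorphism ::
    "('a::complex_star_algebra \<Rightarrow> 'b::complex_star_algebra) \<Rightarrow> bool" where
  "star_ring_isomorphism \<Phi> \<longleftrightarrow>
     bij \<Phi> \<and>
     additive \<Phi> \<and>
     (\<forall>a b. \<Phi> (a * b) = \<Phi> a * \<Phi> b) \<and>
     (\<forall>a. \<Phi> (a\<^sup>\<star>) = (\<Phi> a)\<^sup>\<star>)"

end

theory Submission
  imports Defs
begin

text \<open>With \<open>s = \<alpha>\<^sub>1 + \<alpha>\<^sub>3 + \<alpha>\<^sub>5\<close> and \<open>t = \<alpha>\<^sub>2 + \<alpha>\<^sub>4 + \<alpha>\<^sub>6\<close>, putting \<open>a = 1\<close> in the hypothesis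
  leaves the product \<open>S b c = s bc + t cb*\<close>. It distributes over \<open>x \<oplus> y = \<Phi>\<^sup>-\<^sup>1 (\<Phi> x + \<Phi> y)\<close>, a second
  addition on \<open>\<A>\<close>, and the claim is that \<open>\<oplus>\<close> is \<open>+\<close>. Since \<open>|s| \<noteq> |t|\<close>, multiplying by
  \<open>S (\<mu> 1 + \<nu> p)\<close> for various \<open>\<mu>, \<nu>\<close> yields all complex scalars and the four Peirce projections of \<open>p\<close>
  as \<open>\<oplus>\<close>-homomorphisms, so the comparison can be made corner by corner: off the diagonal by a
  product trick, and on it by mapping to an off-diagonal corner and using primeness.

  For the second part, \<open>d = 1 - \<Phi> 1\<close> is annihilated by the triple product with \<open>\<Phi> 1, \<Phi> 1\<close>, so
  \<open>\<Phi> 1 = 1\<close>. The defect \<open>m b c = \<Phi> (bc) - \<Phi> b \<Phi> c\<close> satisfies \<open>s m b c = - t m c b*\<close>; the map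
  \<open>(b, c) \<mapsto> (c, b*)\<close> has order four, so \<open>s\<^sup>4 m = t\<^sup>4 m\<close> and \<open>m = 0\<close>.\<close>

section \<open>Star algebra and scalar preliminaries\<close>

interpretation complex_space:
  vector_space "scaleC :: complex \<Rightarrow> 'a \<Rightarrow> 'a::complex_star_algebra"
  by unfold_locales
    (simp_all add: scaleC_add_right scaleC_add_left scaleC_scaleC scaleC_one)

lemma star_zero [simp]: "(0 :: 'a::complex_star_algebra)\<^sup>\<star> = 0"
  using star_add[of "0::'a" 0] by simp

lemma star_minus: "(- a)\<^sup>\<star> = - ((a :: 'a::complex_star_algebra)\<^sup>\<star>)"
  using star_add[of a "- a"] by (simp add: eq_neg_iff_add_eq_0 add.commute)

lemma star_diff: "(a - b)\<^sup>\<star> = (a :: 'a::complex_star_algebra)\<^sup>\<star> - b\<^sup>\<star>"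
  using star_add[of a "- b"] by (simp add: star_minus)

lemma star_one [simp]: "(1 :: 'a::unital_complex_star_algebra)\<^sup>\<star> = 1"
  by (metis mult_1 mult_1_right star_mult star_star)

lemma add_nonzero_of_norm_neq:
  fixes s t :: complex
  assumes "cmod s \<noteq> cmod t"
  shows "s + t \<noteq> 0"
  using assms by (metis add_eq_0_iff norm_minus_cancel)

lemma mult_cnj_diff_nonzero:
  assumes "cmod s \<noteq> cmod t"
  shows "s * cnj s - t * cnj t \<noteq> 0"
  using assms
  by (metis eq_iff_diff_eq_0 norm_ge_zero of_real_eq_iff complex_norm_square power2_eq_imp_eq)

section \<open>Scalars as homomorphisms of the twisted addition\<close>

locale twisted_addition =
  fixes s t :: complex
    and opl :: "'a::unital_complex_star_algebra \<Rightarrow> 'a \<Rightarrow> 'a" (infixl "\<oplus>" 65)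
    and S :: "'a \<Rightarrow> 'a \<Rightarrow> 'a"
  defines "S b c \<equiv> s *\<^sub>C (b * c) + t *\<^sub>C (c * b\<^sup>\<star>)"
  assumes norm_neq: "cmod s \<noteq> cmod t"
    and zero_opl [simp]: "0 \<oplus> x = x"
    and opl_zero [simp]: "x \<oplus> 0 = x"
    and S_opl_left: "S (x \<oplus> y) z = S x z \<oplus> S y z"
    and S_opl_right: "S x (y \<oplus> z) = S x y \<oplus> S x z"
begin

definition opl_hom :: "('a \<Rightarrow> 'a) \<Rightarrow> bool" where
  "opl_hom f \<longleftrightarrow> (\<forall>x y. f (x \<oplus> y) = f x \<oplus> f y)"

lemma opl_homD: "opl_hom f \<Longrightarrow> f (x \<oplus> y) = f x \<oplus> f y"
  by (simp add: opl_hom_def)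

lemma opl_hom_comp: "opl_hom f \<Longrightarrow> opl_hom g \<Longrightarrow> opl_hom (\<lambda>x. f (g x))"
  by (simp add: opl_hom_def)

lemma opl_hom_S_right: "opl_hom (S b)"
  by (simp add: opl_hom_def S_opl_right)

lemma opl_hom_S_left: "opl_hom (\<lambda>b. S b c)"
  by (simp add: opl_hom_def S_opl_left)

text \<open>\<open>S\<close> at a scalar \<open>m\<close> is multiplication by
  \<open>s * m + t * cnj m\<close>. This real-linear map in \<open>m\<close> has determinant
  \<open>s * cnj s - t * cnj t\<close>, nonzero by \<open>norm_neq\<close>, so every
  \<open>k\<close> is attained.\<close>

lemma opl_hom_scale: "opl_hom (\<lambda>x. k *\<^sub>C x)"
proof -
  define d where "d = s * cnj s - t * cnj t"
  have d: "d \<noteq> 0" "cnj d = d"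
    using mult_cnj_diff_nonzero[OF norm_neq] by (simp_all add: d_def mult.commute)
  define m where "m = (cnj s * k - t * cnj k) / d"
  have "s * m + t * cnj m = (s * (cnj s * k - t * cnj k) + t * (s * cnj k - cnj t * k)) / d"
    by (simp add: m_def d add_divide_distrib)
  also have "\<dots> = k"
    using d(1) by (simp add: field_simps d_def)
  finally have m: "s * m + t * cnj m = k" .
  have "S (m *\<^sub>C 1) = (\<lambda>x. k *\<^sub>C x)"
    unfolding m[symmetric]
    by (auto simp: S_def fun_eq_iff mult_scaleC_left mult_scaleC_right star_scaleC
        scaleC_add_left scaleC_scaleC)
  then show ?thesis
    using opl_hom_S_right by metis
qed

lemma opl_hom_unscale:
  assumes "opl_hom (\<lambda>x. k *\<^sub>C f x)" "k \<noteq> 0"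
  shows "opl_hom f"
  using opl_hom_comp[OF opl_hom_scale[of "inverse k"] assms(1)] assms(2)
  by (simp add: scaleC_scaleC scaleC_one)

end

section \<open>Peirce corners as homomorphisms\<close>

text \<open>The complement is a parameter \<open>q\<close> instead of \<open>1 - p\<close>, so that
  the roles of \<open>p\<close> and \<open>q\<close> can be exchanged by
  \<open>swapped\<close>.\<close>

locale peirce_addition = twisted_addition +
  fixes p q :: 'a
  assumes sum_pq: "p + q = 1"
    and pp: "p * p = p" and qq: "q * q = q" and pq: "p * q = 0" and qp: "q * p = 0"
    and star_p: "p\<^sup>\<star> = p" and star_q: "q\<^sup>\<star> = q"
begin

lemma swapped: "peirce_addition s t opl q p"
  using sum_pq by unfold_locales (simp_all add: pp qq pq qp star_p star_q add.commute)

lemma cancel_pq: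
  "p * (p * x) = p * x" "q * (q * x) = q * x" "p * (q * x) = 0" "q * (p * x) = 0"
  by (simp_all add: pp qq pq qp flip: mult.assoc)

lemmas pq_simps = pp qq pq qp star_p star_q cancel_pq

lemma peirce_decomposition: "x = p * x * p + p * x * q + q * x * p + q * x * q"
proof -
  have "x = (p + q) * x * (p + q)" by (simp add: sum_pq)
  then show ?thesis by (simp add: algebra_simps)
qed

text \<open>Such operators compose entrywise, so a single corner is isolated by multiplying
  coefficient tuples until one entry survives.\<close>

definition peirce_diag :: "complex \<Rightarrow> complex \<Rightarrow> complex \<Rightarrow> complex \<Rightarrow> 'a \<Rightarrow> 'a" where
  "peirce_diag a b c d x =
     a *\<^sub>C (p * x * p) + b *\<^sub>C (p * x * q) + c *\<^sub>C (q * x * p) + d *\<^sub>C (q * x * q)"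

lemma peirce_diag_comp:
  "peirce_diag a b c d (peirce_diag a' b' c' d' x) = peirce_diag (a * a') (b * b') (c * c') (d * d') x"
  by (simp add: peirce_diag_def algebra_simps mult_scaleC_left mult_scaleC_right
      scaleC_scaleC pq_simps)

lemma opl_hom_peirce_diag_comp:
  "opl_hom (peirce_diag a b c d) \<Longrightarrow> opl_hom (peirce_diag a' b' c' d') \<Longrightarrow>
   opl_hom (peirce_diag (a * a') (b * b') (c * c') (d * d'))"
  using opl_hom_comp[of "peirce_diag a b c d" "peirce_diag a' b' c' d'"]
  by (simp add: peirce_diag_comp)

text \<open>For \<open>S\<close> at \<open>m p + n q\<close>, left multiplication scales the rows by
  \<open>m\<close>, \<open>n\<close>, and right multiplication by the adjoint scales the columns by
  the conjugates.\<close>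

lemma opl_hom_peirce_diag:
  "opl_hom (peirce_diag (s * m + t * cnj m) (s * m + t * cnj n)
     (s * n + t * cnj m) (s * n + t * cnj n))"
proof -
  have "S (m *\<^sub>C p + n *\<^sub>C q) x = peirce_diag (s * m + t * cnj m) (s * m + t * cnj n)
     (s * n + t * cnj m) (s * n + t * cnj n) x" for x
  proof -
    have "S (m *\<^sub>C p + n *\<^sub>C q) x
        = (s * m) *\<^sub>C (p * x * (p + q)) + (s * n) *\<^sub>C (q * x * (p + q))
        + (t * cnj m) *\<^sub>C ((p + q) * x * p) + (t * cnj n) *\<^sub>C ((p + q) * x * q)"
      unfolding sum_pq
      by (simp add: S_def algebra_simps mult_scaleC_left mult_scaleC_right
          scaleC_scaleC star_add star_scaleC star_p star_q scaleC_add_right)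
    also have "\<dots> = peirce_diag (s * m + t * cnj m) (s * m + t * cnj n)
     (s * n + t * cnj m) (s * n + t * cnj n) x"
      by (simp add: peirce_diag_def algebra_simps scaleC_add_right scaleC_add_left)
    finally show ?thesis .
  qed
  then show ?thesis
    using opl_hom_S_right by (metis ext)
qed

text \<open>Here \<open>S\<close> is a multiple of a single product, so left and right
  multiplications are homomorphisms separately.\<close>

lemma opl_hom_corners_one_sided:
  assumes "s = 0 \<or> t = 0"
  shows "opl_hom (\<lambda>x. p * x * p)" "opl_hom (\<lambda>x. p * x * q)"
proof -
  have "opl_hom (\<lambda>x. b * x) \<and> opl_hom (\<lambda>x. x * b)" for b
  proof (cases "t = 0")
    case True
    then have "s \<noteq> 0" using norm_neq by auto
    then show ?thesis
      using True opl_hom_S_right[of b] opl_hom_S_left[of b]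
      by (auto intro: opl_hom_unscale[of s] simp: S_def[abs_def])
  next
    case False
    then have s: "s = 0" using assms by simp
    have right: "opl_hom (\<lambda>x. x * b)" for b
      using s False opl_hom_S_right[of "b\<^sup>\<star>"]
      by (auto intro: opl_hom_unscale[of t] simp: S_def[abs_def] star_star)
    have left_star: "opl_hom (\<lambda>x. b * x\<^sup>\<star>)" for b
      using s False opl_hom_S_left[of b]
      by (auto intro: opl_hom_unscale[of t] simp: S_def[abs_def])
    \<comment> \<open>The first argument of \<open>S\<close> enters starred; applying such a map
      twice cancels the star.\<close>
    have "opl_hom (\<lambda>x. b * (1 * x\<^sup>\<star>)\<^sup>\<star>)"
      by (rule opl_hom_comp[OF left_star left_star])
    with right show ?thesis by (simp add: star_star)
  qed
  then show "opl_hom (\<lambda>x. p * x * p)" "opl_hom (\<lambda>x. p * x * q)"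
    by (auto intro: opl_hom_comp[of "\<lambda>x. x * p"] opl_hom_comp[of "\<lambda>x. x * q"])
qed

text \<open>The composite of \<open>M1\<close>, \<open>M2\<close>, \<open>D1\<close> keeps only the
  \<open>p\<close>-\<open>p\<close> corner, that of \<open>M2\<close>, \<open>D1\<close>,
  \<open>D2\<close> only the \<open>p\<close>-\<open>q\<close> corner. The surviving coefficients
  are nonzero because \<open>s\<close> and \<open>t\<close> are nonzero with different
  moduli.\<close>

lemma opl_hom_corners_two_sided:
  assumes "s \<noteq> 0" "t \<noteq> 0"
  shows "opl_hom (\<lambda>x. p * x * p)" "opl_hom (\<lambda>x. p * x * q)"
proof -
  let ?d = "s * cnj s - t * cnj t"
  \<comment> \<open>\<open>M\<^sub>1\<close> and \<open>M\<^sub>2\<close> each annihilate exactly one off-diagonal corner.\<close>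
  have M1: "opl_hom (peirce_diag (- (t * (s + cnj t))) 0 ?d (s * (cnj s + t)))"
    using opl_hom_peirce_diag[of "- t" "cnj s"] by (simp add: algebra_simps)
  have M2: "opl_hom (peirce_diag (s * (cnj s + t)) ?d 0 (- (t * (s + cnj t))))"
    using opl_hom_peirce_diag[of "cnj s" "- t"] by (simp add: algebra_simps)
  have D1: "opl_hom (peirce_diag (s + t) s t 0)"
    using opl_hom_peirce_diag[of 1 0] by simp
  have D2: "opl_hom (peirce_diag 0 t s (s + t))"
    using opl_hom_peirce_diag[of 0 1] by simp
  have d: "?d \<noteq> 0" using mult_cnj_diff_nonzero[OF norm_neq] .
  have st: "s + t \<noteq> 0"
    using add_nonzero_of_norm_neq[OF norm_neq] by simp
  have st1: "cnj s + t \<noteq> 0"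
    using add_nonzero_of_norm_neq[of "cnj s" t] norm_neq by simp
  have st2: "s + cnj t \<noteq> 0"
    using add_nonzero_of_norm_neq[of s "cnj t"] norm_neq by simp
  let ?k = "- (t * (s + cnj t)) * (s * (cnj s + t) * (s + t))"
  have "opl_hom (peirce_diag ?k 0 0 0)"
    using opl_hom_peirce_diag_comp[OF M1 opl_hom_peirce_diag_comp[OF M2 D1]] by simp
  then have "opl_hom (\<lambda>x. ?k *\<^sub>C (p * x * p))"
    by (simp only: peirce_diag_def[abs_def] complex_space.scale_zero_left add_0_right)
  then show "opl_hom (\<lambda>x. p * x * p)"
    by (rule opl_hom_unscale) (use assms st st1 st2 in simp)
  have "opl_hom (peirce_diag 0 (?d * (s * t)) 0 0)"
    using opl_hom_peirce_diag_comp[OF M2 opl_hom_peirce_diag_comp[OF D1 D2]] by simp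
  then have "opl_hom (\<lambda>x. (?d * (s * t)) *\<^sub>C (p * x * q))"
    by (simp only: peirce_diag_def[abs_def] complex_space.scale_zero_left add_0_right add_0_left)
  then show "opl_hom (\<lambda>x. p * x * q)"
    by (rule opl_hom_unscale) (use assms d in simp)
qed

lemma opl_hom_pp: "opl_hom (\<lambda>x. p * x * p)" and opl_hom_pq: "opl_hom (\<lambda>x. p * x * q)"
  using opl_hom_corners_one_sided opl_hom_corners_two_sided by blast+

lemma opl_hom_qq: "opl_hom (\<lambda>x. q * x * q)" and opl_hom_qp: "opl_hom (\<lambda>x. q * x * p)"
  using peirce_addition.opl_hom_pp[OF swapped] peirce_addition.opl_hom_pq[OF swapped]
  by blast+

lemmas opl_corners =
  opl_homD[OF opl_hom_pp] opl_homD[OF opl_hom_pq] opl_homD[OF opl_hom_qp] opl_homD[OF opl_hom_qq]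

section \<open>Agreement of the two additions, corner by corner\<close>

lemma opl_eq_addI:
  assumes "p * x * p \<oplus> p * y * p = p * x * p + p * y * p"
    and "p * x * q \<oplus> p * y * q = p * x * q + p * y * q"
    and "q * x * p \<oplus> q * y * p = q * x * p + q * y * p"
    and "q * x * q \<oplus> q * y * q = q * x * q + q * y * q"
  shows "x \<oplus> y = x + y"
proof -
  have "x \<oplus> y = (p * x * p + p * y * p) + (p * x * q + p * y * q)
      + (q * x * p + q * y * p) + (q * x * q + q * y * q)"
    by (subst peirce_decomposition) (simp only: opl_corners assms)
  also have "\<dots> = (p * x * p + p * x * q + q * x * p + q * x * q)
      + (p * y * p + p * y * q + q * y * p + q * y * q)"
    by (simp only: ac_simps)
  finally show ?thesis
    by (simp only: peirce_decomposition[symmetric])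
qed

text \<open>The idea is \<open>(p + a) * (q + b) = a + b\<close>, where both factors are also \<open>\<oplus>\<close>-sums.\<close>

lemma opl_off_diagonal: "p * x * q \<oplus> p * y * q = p * x * q + p * y * q"
proof -
  define a where "a = p * y * q"
  define b where "b = p * x * q"
  have a: "p * a = a" "a * q = a" "q * a = 0" "a * p = 0"
    and b: "p * b = b" "b * q = b" "q * b = 0" "b * p = 0"
    by (simp_all add: a_def b_def pq_simps mult.assoc)
  have bs: "q * b\<^sup>\<star> = b\<^sup>\<star>" "b\<^sup>\<star> * p = b\<^sup>\<star>" "p * b\<^sup>\<star> = 0" "b\<^sup>\<star> * q = 0"
    and as: "q * a\<^sup>\<star> = a\<^sup>\<star>" "a\<^sup>\<star> * p = a\<^sup>\<star>" "p * a\<^sup>\<star> = 0" "a\<^sup>\<star> * q = 0"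
    using arg_cong[OF a(1), of star] arg_cong[OF a(2), of star]
      arg_cong[OF a(3), of star] arg_cong[OF a(4), of star]
      arg_cong[OF b(1), of star] arg_cong[OF b(2), of star]
      arg_cong[OF b(3), of star] arg_cong[OF b(4), of star]
    by (simp_all add: star_mult star_p star_q)
  have assoc: "p * (a * z) = a * z" "a * (q * z) = a * z" "q * (a * z) = 0" "a * (p * z) = 0"
     "p * (b * z) = b * z" "b * (q * z) = b * z" "q * (b * z) = 0" "b * (p * z) = 0"
     "q * (b\<^sup>\<star> * z) = b\<^sup>\<star> * z" "b\<^sup>\<star> * (p * z) = b\<^sup>\<star> * z" "p * (b\<^sup>\<star> * z) = 0" "b\<^sup>\<star> * (q * z) = 0"
     "q * (a\<^sup>\<star> * z) = a\<^sup>\<star> * z" "a\<^sup>\<star> * (p * z) = a\<^sup>\<star> * z" "p * (a\<^sup>\<star> * z) = 0" "a\<^sup>\<star> * (q * z) = 0"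
    for z
    by (simp_all add: a b as bs flip: mult.assoc)
  have "a * b = a * q * (p * b)" "b * a = b * q * (p * a)" by (simp_all add: a b)
  then have ab: "a * b = 0" "b * a = 0" by (simp_all add: mult.assoc pq_simps)
  note ab_simps = a b as bs assoc ab pq_simps mult.assoc distrib_left distrib_right
    mult_scaleC_left mult_scaleC_right star_add star_star S_def
  \<comment> \<open>The two summands lie in different corners, so in each corner one of them
    vanishes.\<close>
  have pa: "p \<oplus> a = p + a" and qb: "q \<oplus> b = q + b"
    and pb: "p \<oplus> b = p + b" and qas: "q \<oplus> a\<^sup>\<star> = q + a\<^sup>\<star>"
    by (rule opl_eq_addI; simp add: ab_simps)+
  have "b \<oplus> a = b + a"
  proof (cases "s = 0")
    case False
    \<comment> \<open>Cutting down to the \<open>p\<close>-\<open>q\<close> corner removes the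
      contributions of the \<open>t\<close> term of \<open>S\<close>.\<close>
    have "s *\<^sub>C b \<oplus> s *\<^sub>C a
        = p * ((S p q \<oplus> S p b) \<oplus> (S a q \<oplus> S a b)) * q"
      unfolding opl_corners by (simp add: ab_simps)
    also have "\<dots> = p * (S p (q + b) \<oplus> S a (q + b)) * q"
      by (simp only: S_opl_right flip: qb)
    also have "\<dots> = p * S (p + a) (q + b) * q"
      by (simp only: S_opl_left flip: pa)
    also have "\<dots> = s *\<^sub>C (b + a)"
      by (simp add: ab_simps scaleC_add_right add.commute)
    finally have "s *\<^sub>C (b \<oplus> a) = s *\<^sub>C (b + a)"
      by (simp only: opl_homD[OF opl_hom_scale])
    with False show ?thesis by simp
  next
    case True
    then have t: "t \<noteq> 0" using norm_neq by auto
    \<comment> \<open>Now \<open>S\<close> reverses its factors and stars the first, so the product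
      used is \<open>(p + b) * (q + a)\<close>, with \<open>q\<close> plus the adjoint of
      \<open>a\<close> as first argument.\<close>
    have "t *\<^sub>C b \<oplus> t *\<^sub>C a
        = p * ((S q p \<oplus> S q b) \<oplus> (S (a\<^sup>\<star>) p \<oplus> S (a\<^sup>\<star>) b)) * q"
      unfolding opl_corners by (simp add: ab_simps)
    also have "\<dots> = p * (S q (p + b) \<oplus> S (a\<^sup>\<star>) (p + b)) * q"
      by (simp only: S_opl_right flip: pb)
    also have "\<dots> = p * S (q + a\<^sup>\<star>) (p + b) * q"
      by (simp only: S_opl_left flip: qas)
    also have "\<dots> = t *\<^sub>C (b + a)"
      by (simp add: ab_simps scaleC_add_right add.commute)
    finally have "t *\<^sub>C (b \<oplus> a) = t *\<^sub>C (b + a)"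
      by (simp only: opl_homD[OF opl_hom_scale])
    with t show ?thesis by simp
  qed
  then show ?thesis by (simp add: a_def b_def)
qed

text \<open>\<open>S\<close> carries the diagonal corner into an off-diagonal one, where the
  additions agree. So the defect \<open>h - a - b\<close>, or its adjoint if \<open>s = 0\<close>,
  annihilates everything up to a factor \<open>q\<close>, and primeness applies.\<close>

lemma opl_diagonal:
  assumes prime: "prime_algebra TYPE('a)" and "q \<noteq> 0"
  shows "p * x * p \<oplus> p * y * p = p * x * p + p * y * p"
proof -
  define a where "a = p * x * p"
  define b where "b = p * y * p"
  define h where "h = a \<oplus> b"
  have a: "p * a * p = a" and b: "p * b * p = b"
    by (simp_all add: a_def b_def pq_simps mult.assoc)
  then have h: "p * h * p = h" by (simp add: h_def opl_corners)
  have corner: "p * u = u" "u * p = u" "p * u\<^sup>\<star> = u\<^sup>\<star>" "u\<^sup>\<star> * p = u\<^sup>\<star>" "q * u\<^sup>\<star> = 0"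
    if "p * u * p = u" for u
  proof -
    show u: "p * u = u" "u * p = u"
      using that by (metis mult.assoc pp)+
    show us: "p * u\<^sup>\<star> = u\<^sup>\<star>" "u\<^sup>\<star> * p = u\<^sup>\<star>"
      using u by (metis star_mult star_p)+
    show "q * u\<^sup>\<star> = 0"
      using us(1) by (metis cancel_pq(4))
  qed
  have "h = a + b"
  proof (cases "s = 0")
    case False
    have "(h - a - b) * z * q = 0" for z
    proof -
      \<comment> \<open>The \<open>t\<close> term drops out because \<open>q\<close> annihilates the
        adjoint of \<open>u\<close>.\<close>
      have S: "S u (p * z * q) = s *\<^sub>C (p * (u * z) * q)" if "p * u * p = u" for u
        using corner[OF that] by (simp add: S_def mult.assoc flip: mult.assoc[of u p] mult.assoc[of p u])
      have "s *\<^sub>C (p * (h * z) * q) = s *\<^sub>C (p * (a * z) * q) \<oplus> s *\<^sub>C (p * (b * z) * q)"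
        using S_opl_left[of a b "p * z * q"] by (simp add: S a b h flip: h_def)
      also have "\<dots> = s *\<^sub>C (p * (a * z) * q + p * (b * z) * q)"
        by (simp add: opl_off_diagonal flip: opl_homD[OF opl_hom_scale])
      finally have "p * (h * z) * q = p * (a * z) * q + p * (b * z) * q"
        using False by simp
      then show ?thesis
        using corner(1)[OF a] corner(1)[OF b] corner(1)[OF h] by (simp add: algebra_simps flip: mult.assoc)
    qed
    then have "h - a - b = 0"
      using prime \<open>q \<noteq> 0\<close> unfolding prime_algebra_def by blast
    then show ?thesis by (simp add: algebra_simps)
  next
    case True
    then have t: "t \<noteq> 0" using norm_neq by auto
    have "q * z * (h - a - b)\<^sup>\<star> = 0" for z
    proof -
      have S: "S u (q * z * p) = t *\<^sub>C (q * (z * u\<^sup>\<star>) * p)" if "p * u * p = u" for u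
        using corner[OF that] True by (simp add: S_def mult.assoc)
      have "t *\<^sub>C (q * (z * h\<^sup>\<star>) * p) = t *\<^sub>C (q * (z * a\<^sup>\<star>) * p) \<oplus> t *\<^sub>C (q * (z * b\<^sup>\<star>) * p)"
        using S_opl_left[of a b "q * z * p"] by (simp add: S a b h flip: h_def)
      also have "\<dots> = t *\<^sub>C (q * (z * a\<^sup>\<star>) * p + q * (z * b\<^sup>\<star>) * p)"
        by (simp add: peirce_addition.opl_off_diagonal[OF swapped]
            flip: opl_homD[OF opl_hom_scale])
      finally have "q * (z * h\<^sup>\<star>) * p = q * (z * a\<^sup>\<star>) * p + q * (z * b\<^sup>\<star>) * p"
        using t by simp
      then have "q * (z * h\<^sup>\<star>) = q * (z * a\<^sup>\<star>) + q * (z * b\<^sup>\<star>)"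
        by (simp add: mult.assoc corner(4)[OF a] corner(4)[OF b] corner(4)[OF h])
      then show ?thesis
        by (simp add: star_diff right_diff_distrib mult.assoc)
    qed
    then have "(h - a - b)\<^sup>\<star> = 0"
      using prime \<open>q \<noteq> 0\<close> unfolding prime_algebra_def by blast
    then have "h - a - b = 0" by (metis star_star star_zero)
    then show ?thesis by (simp add: algebra_simps)
  qed
  then show ?thesis by (simp add: h_def a_def b_def)
qed

lemma opl_eq_add:
  assumes "prime_algebra TYPE('a)" "p \<noteq> 0" "q \<noteq> 0"
  shows "x \<oplus> y = x + y"
  by (rule opl_eq_addI)
    (simp_all add: assms opl_off_diagonal opl_diagonal
      peirce_addition.opl_off_diagonal[OF swapped] peirce_addition.opl_diagonal[OF swapped])

end

section \<open>Transfer to \<Phi>: additivity and multiplicativity\<close>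

text \<open>The target product is an abstract biadditive \<open>B\<close>: until
  \<open>\<Phi> 1\<close> is known to be the identity, the triple product with first entry
  \<open>\<Phi> 1\<close> need not have the form of \<open>S\<close>.\<close>

lemma additive_of_twisted_product:
  fixes \<Phi> :: "'a::unital_complex_star_algebra \<Rightarrow> 'b::ab_group_add"
  assumes st: "cmod s \<noteq> cmod t"
    and prime: "prime_algebra TYPE('a)"
    and ex: "\<exists>p :: 'a. nontrivial_projection p"
    and bij: "bij \<Phi>"
    and zero: "\<Phi> 0 = 0"
    and prod: "\<And>b c. \<Phi> (s *\<^sub>C (b * c) + t *\<^sub>C (c * b\<^sup>\<star>)) = B (\<Phi> b) (\<Phi> c)"
    and B_left: "\<And>x y z. B (x + y) z = B x z + B y z"
    and B_right: "\<And>x y z. B x (y + z) = B x y + B x z"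
  shows "additive \<Phi>"
proof -
  from ex obtain p :: 'a where p: "p\<^sup>\<star> = p" "p * p = p" "p \<noteq> 0" "p \<noteq> 1"
    unfolding nontrivial_projection_def is_projection_def by metis
  define opl where "opl x y = inv \<Phi> (\<Phi> x + \<Phi> y)" for x y
  have \<Phi>_opl: "\<Phi> (opl x y) = \<Phi> x + \<Phi> y" for x y
    by (simp add: opl_def bij_is_surj[OF bij] surj_f_inv_f)
  have inj: "\<Phi> x = \<Phi> y \<Longrightarrow> x = y" for x y
    using bij by (meson bij_is_inj injD)
  \<comment> \<open>The axioms on \<open>opl\<close> are checked after applying the injective
    \<Phi>, where they become biadditivity of \<open>B\<close> and
    \<open>\<Phi> 0 = 0\<close>.\<close>
  interpret peirce_addition s t opl "\<lambda>b c. s *\<^sub>C (b * c) + t *\<^sub>C (c * b\<^sup>\<star>)" p "1 - p"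
    by unfold_locales
      (auto intro!: inj simp: st \<Phi>_opl zero prod B_left B_right p algebra_simps star_diff)
  show ?thesis
  proof
    fix x y
    show "\<Phi> (x + y) = \<Phi> x + \<Phi> y"
      using opl_eq_add[OF prime, of x y] p \<Phi>_opl[of x y] by simp
  qed
qed

lemma star_ring_isomorphism_of_twisted_product:
  fixes \<Phi> :: "'a::unital_complex_star_algebra \<Rightarrow> 'b::unital_complex_star_algebra"
  assumes st: "cmod s \<noteq> cmod t"
    and bij: "bij \<Phi>"
    and "additive \<Phi>"
    and one: "\<Phi> 1 = 1"
    and t: "t \<noteq> 0" "\<And>a. \<Phi> (t *\<^sub>C a) = t *\<^sub>C \<Phi> a"
    and prod: "\<And>b c. \<Phi> (s *\<^sub>C (b * c) + t *\<^sub>C (c * b\<^sup>\<star>))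
      = s *\<^sub>C (\<Phi> b * \<Phi> c) + t *\<^sub>C (\<Phi> c * (\<Phi> b)\<^sup>\<star>)"
  shows "star_ring_isomorphism \<Phi>"
proof -
  interpret additive \<Phi> by fact
  \<comment> \<open>With first factor 1, additivity and homogeneity in \<open>t\<close> cancel the
    \<open>t\<close> terms; with second factor 1, the \<open>s\<close> terms then cancel and the
    star is left.\<close>
  have s: "\<Phi> (s *\<^sub>C a) = s *\<^sub>C \<Phi> a" for a
    using prod[of 1 a] by (simp add: one add t)
  have star: "\<Phi> (a\<^sup>\<star>) = (\<Phi> a)\<^sup>\<star>" for a
    using prod[of a 1] by (simp add: one add t s)
  define m where "m b c = \<Phi> (b * c) - \<Phi> b * \<Phi> c" for b c
  have step: "s *\<^sub>C m b c = - (t *\<^sub>C m c (b\<^sup>\<star>))" for b c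
    using prod[of b c]
    by (simp add: m_def add t s star complex_space.scale_right_diff_distrib algebra_simps)
  have "m b c = 0" for b c
  proof -
    \<comment> \<open>Two applications of \<open>step\<close> star both arguments and cancel the
      signs; two more restore the original pair.\<close>
    have step2: "(s * s) *\<^sub>C m b c = (t * t) *\<^sub>C m (b\<^sup>\<star>) (c\<^sup>\<star>)" for b c
    proof -
      have "(s * s) *\<^sub>C m b c = - (s *\<^sub>C (t *\<^sub>C m c (b\<^sup>\<star>)))"
        by (simp only: step complex_space.scale_minus_right flip: scaleC_scaleC)
      also have "\<dots> = - (t *\<^sub>C (s *\<^sub>C m c (b\<^sup>\<star>)))"
        by (simp only: scaleC_scaleC mult.commute)
      also have "\<dots> = (t * t) *\<^sub>C m (b\<^sup>\<star>) (c\<^sup>\<star>)"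
        by (simp only: step complex_space.scale_minus_right minus_minus scaleC_scaleC)
      finally show ?thesis .
    qed
    have "(s * s * (s * s)) *\<^sub>C m b c = (t * t) *\<^sub>C ((s * s) *\<^sub>C m (b\<^sup>\<star>) (c\<^sup>\<star>))"
      by (metis scaleC_scaleC step2 mult.commute)
    also have "\<dots> = (t * t * (t * t)) *\<^sub>C m b c"
      by (simp only: step2 star_star scaleC_scaleC)
    finally have "s ^ 4 *\<^sub>C m b c = t ^ 4 *\<^sub>C m b c"
      by (simp add: power4_eq_xxxx mult.assoc)
    moreover have "s ^ 4 \<noteq> t ^ 4"
      using st by (metis norm_ge_zero norm_power power_eq_imp_eq_base zero_less_numeral)
    ultimately show ?thesis
      by (simp add: complex_space.scale_cancel_right)
  qed
  then show ?thesis
    using bij \<open>additive \<Phi>\<close> star by (simp add: star_ring_isomorphism_def m_def)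
qed

section \<open>Reduction of the triple product\<close>

theorem theorem1p1:
  fixes \<alpha>\<^sub>1 \<alpha>\<^sub>2 \<alpha>\<^sub>3 \<alpha>\<^sub>4 \<alpha>\<^sub>5 \<alpha>\<^sub>6 :: complex
    and \<Phi> :: "'a::unital_complex_star_algebra \<Rightarrow> 'b::unital_complex_star_algebra"
  assumes "cmod (\<alpha>\<^sub>1 + \<alpha>\<^sub>3 + \<alpha>\<^sub>5) - cmod (\<alpha>\<^sub>2 + \<alpha>\<^sub>4 + \<alpha>\<^sub>6) \<noteq> 0"
    and "prime_algebra TYPE('a)"
    and "\<exists>p :: 'a. nontrivial_projection p"
    and "bij \<Phi>"
    and "\<And>a b c.
      \<Phi> (\<alpha>\<^sub>1 *\<^sub>C (a * b * c) + \<alpha>\<^sub>2 *\<^sub>C (a\<^sup>\<star> * c * b\<^sup>\<star>) + \<alpha>\<^sub>3 *\<^sub>C (b * a\<^sup>\<star> * c)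
         + \<alpha>\<^sub>4 *\<^sub>C (c * a * b\<^sup>\<star>) + \<alpha>\<^sub>5 *\<^sub>C (b * c * a) + \<alpha>\<^sub>6 *\<^sub>C (c * b\<^sup>\<star> * a\<^sup>\<star>))
      = \<alpha>\<^sub>1 *\<^sub>C (\<Phi> a * \<Phi> b * \<Phi> c) + \<alpha>\<^sub>2 *\<^sub>C ((\<Phi> a)\<^sup>\<star> * \<Phi> c * (\<Phi> b)\<^sup>\<star>)
         + \<alpha>\<^sub>3 *\<^sub>C (\<Phi> b * (\<Phi> a)\<^sup>\<star> * \<Phi> c) + \<alpha>\<^sub>4 *\<^sub>C (\<Phi> c * \<Phi> a * (\<Phi> b)\<^sup>\<star>)
         + \<alpha>\<^sub>5 *\<^sub>C (\<Phi> b * \<Phi> c * \<Phi> a) + \<alpha>\<^sub>6 *\<^sub>C (\<Phi> c * (\<Phi> b)\<^sup>\<star> * (\<Phi> a)\<^sup>\<star>)"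
  shows "additive \<Phi> \<and>
    (is_projection (\<Phi> 1) \<and>
     \<alpha>\<^sub>2 + \<alpha>\<^sub>4 + \<alpha>\<^sub>6 \<noteq> 0 \<and>
     (\<forall>a. \<Phi> ((\<alpha>\<^sub>2 + \<alpha>\<^sub>4 + \<alpha>\<^sub>6) *\<^sub>C a) = (\<alpha>\<^sub>2 + \<alpha>\<^sub>4 + \<alpha>\<^sub>6) *\<^sub>C \<Phi> a)
     \<longrightarrow> star_ring_isomorphism \<Phi>)"
proof -
  let ?s = "\<alpha>\<^sub>1 + \<alpha>\<^sub>3 + \<alpha>\<^sub>5" and ?t = "\<alpha>\<^sub>2 + \<alpha>\<^sub>4 + \<alpha>\<^sub>6"
  define T where "T x y z = \<alpha>\<^sub>1 *\<^sub>C (x * y * z) + \<alpha>\<^sub>2 *\<^sub>C (x\<^sup>\<star> * z * y\<^sup>\<star>)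
      + \<alpha>\<^sub>3 *\<^sub>C (y * x\<^sup>\<star> * z) + \<alpha>\<^sub>4 *\<^sub>C (z * x * y\<^sup>\<star>)
      + \<alpha>\<^sub>5 *\<^sub>C (y * z * x) + \<alpha>\<^sub>6 *\<^sub>C (z * y\<^sup>\<star> * x\<^sup>\<star>)" for x y z :: 'b
  have norm_neq: "cmod ?s \<noteq> cmod ?t" using assms(1) by simp
  have prod: "\<Phi> (?s *\<^sub>C (b * c) + ?t *\<^sub>C (c * b\<^sup>\<star>)) = T (\<Phi> 1) (\<Phi> b) (\<Phi> c)" for b c
    using assms(5)[of 1 b c] by (simp add: T_def scaleC_add_left algebra_simps)
  have surj: "\<exists>x. \<Phi> x = y" for y
    using assms(4) by (metis bij_pointE)
  \<comment> \<open>Taking \<open>a = z\<close> and \<open>b = c = 0\<close> gives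
    \<open>\<Phi> 0\<close> on the left and zero on the right.\<close>
  obtain z where "\<Phi> z = 0" using surj by blast
  then have zero: "\<Phi> 0 = 0"
    using assms(5)[of z 0 0] by simp
  have additive: "additive \<Phi>"
    by (rule additive_of_twisted_product[OF norm_neq assms(2-4) zero prod])
      (simp_all add: T_def star_add algebra_simps scaleC_add_right)
  moreover have "star_ring_isomorphism \<Phi>"
    if e: "is_projection (\<Phi> 1)" and t: "?t \<noteq> 0" "\<forall>a. \<Phi> (?t *\<^sub>C a) = ?t *\<^sub>C \<Phi> a"
  proof -
    obtain d where d: "\<Phi> d = 1 - \<Phi> 1" using surj by blast
    \<comment> \<open>In each term the projection \<open>\<Phi> 1\<close> stands next to its
      complement \<open>1 - \<Phi> 1\<close>.\<close>
    have "T (\<Phi> 1) (\<Phi> 1) (\<Phi> d) = 0"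
      using e by (simp add: T_def d is_projection_def algebra_simps)
    then have "\<Phi> ((?s + ?t) *\<^sub>C d) = \<Phi> 0"
      using prod[of 1 d] by (simp add: zero scaleC_add_left)
    then have "(?s + ?t) *\<^sub>C d = 0"
      using assms(4) by (meson bij_is_inj injD)
    moreover have "?s + ?t \<noteq> 0"
      using add_nonzero_of_norm_neq[OF norm_neq] by simp
    ultimately have "d = 0" by simp
    then have one: "\<Phi> 1 = 1" using d zero by simp
    have "\<Phi> (?s *\<^sub>C (b * c) + ?t *\<^sub>C (c * b\<^sup>\<star>))
        = ?s *\<^sub>C (\<Phi> b * \<Phi> c) + ?t *\<^sub>C (\<Phi> c * (\<Phi> b)\<^sup>\<star>)" for b c
      unfolding prod by (simp add: T_def one scaleC_add_left algebra_simps)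
    with norm_neq assms(4) additive one t show ?thesis
      by (intro star_ring_isomorphism_of_twisted_product) auto
  qed
  ultimately show ?thesis by blast
qed

end
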